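(* Given a threshold service policy $(T,\mu_l,\mu_h)$, where $T$ is a positive integer and $0<\mu_l<\mu_h$, the following hold, where "equilibrium" means recurrent-class equilibrium. (i) In the range $\{0,1,\dots,T\}$ there exist at most two values $\hat n_0$ for which the threshold strategy $\underline{\tilde p}(\hat n_0)$ is an equilibrium, and: (a) if $\tilde R\mu_l\le T$ and $\tilde R\mu_l\in\mathbb Z$, then there exist two distinct equilibria, with $\hat n_0^{(1)}=\tilde R\mu_l-1$ and $\hat n_0^{(2)}=\tilde R\mu_l$; (b) if $\tilde R\mu_l<T$ and $\tilde R\mu_l\notin\mathbb Z$, then $\hat n_0=\lfloor\tilde R\mu_l\rfloor$ is the unique equilibrium in this range; (c) if $T<\tilde R\mu_l\le T+\frac{\mu_l}{\mu_h}$, then $\hat n_0=T=\lfloor\tilde R\mu_l\rfloor$ is the unique equilibrium in this range; (d) if $\tilde R\mu_l>T+\frac{\mu_l}{\mu_h}$, then there is no equilibrium $\underline{\tilde p}(n_0)$ with $n_0\in\{0,1,\dots,T\}$. (ii) In the range $\{T+1,T+2,\dots\}$, a pure threshold strategy $\underline{\tilde p}(\hat n_0)$ is an equilibrium if and only if $$L\le\hat n_0\le U\quad\text{and}\quad \tilde R-\frac1{\mu_h}\le W\left(\hat n_0-1,\hat n_0;\underline{\tilde p}(\hat n_0)\right)\le\tilde R,$$ where $L=\max\left\{\left(\tilde R-\frac1{\mu_h}\right)\mu_l,\;T+1\right\}$ and $U=\max\{\tilde R\mu_h,\;T+1\}$.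
   Context: Model. Customers arrive at a single-server first-come-first-served queue according to a Poisson process with rate $\lambda>0$. Threshold service policy $(T,\mu_l,\mu_h)$: when $n\ge1$ customers are in the system, service is provided at exponential rate $\mu_n$, where $\mu_n=\mu_l$ if $n\le T$ and $\mu_n=\mu_h$ if $n>T$. Each arriving customer observes the number of customers present and either joins or balks. A joining customer receives a reward $R\ge0$ at service completion and pays $C>0$ per unit of time in the system, with no reneging. Let $\tilde R=R/C$. A strategy is a vector $\underline p=(p_0,p_1,\dots)\in[0,1]^\infty$, where $p_n$ is the probability that a customer who finds $n$ customers upon arrival joins. Let $n_0(\underline p)=\min\{n:p_n=0\}$. Pure threshold strategy $\underline{\tilde p}(n_0)$, $n_0\ge 0$ an integer: $p_n=1$ for $n\le n_0-1$ and $p_n=0$ for $n\ge n_0$ (so $\underline{\tilde p}(0)$ always balks). Delay function. For $0\le n<m$, $W(n,m;\underline p)$ is the expected remaining sojourn time of a tagged customer in the system who has $n$ customers in front of her when there are $m$ customers in total (including her), when all future arrivals follow $\underline p$. That is, it is the expected time until departure of the continuous-time Markov chain started at $(n,m)$ with transitions $(i,k)\to(i,k+1)$ at rate $\lambda p_k$, $(i,k)\to(i-1,k-1)$ at rate $\mu_k$ if $i\ge1$, and $(0,k)\to$ departure at rate $\mu_k$. $W(n;\underline p)=W(n,n+1;\underline p)$ is the expected sojourn time of a customer who finds $n$ customers upon arrival and joins. Recurrent-class equilibria. A strategy $\underline p$ with $n_0(\underline p)<\infty$ is a recurrent-class equilibrium if, for every $n\le n_0(\underline p)$: $\tilde R-W(n;\underline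 p)\le0$ if $p_n=0$; $\tilde R-W(n;\underline p)\ge0$ if $p_n=1$; and $\tilde R-W(n;\underline p)=0$ if $p_n\in(0,1)$.
   Formalization: In (a), the equilibrium with threshold R̃μ_l − 1 is claimed only for R > 0; for R = 0 that threshold would be −1, which is not a strategy, so only the equilibrium with threshold R̃μ_l = 0 is claimed. *)

theory Defs
  imports "HOL-Probability.Probability"
begin

text \<open>
  State of a tagged customer: \<open>Some (i, k)\<close> means that she has \<open>i\<close> customers in front of her
  and that \<open>k\<close> customers are in the system, including her (so \<open>i < k\<close>); \<open>None\<close> means that
  she has departed.
\<close>

type_synonym tagged_state = "(nat \<times> nat) option"

definition threshold_rate :: "nat \<Rightarrow> real \<Rightarrow> real \<Rightarrow> nat \<Rightarrow> real" where
  "threshold_rate T \<mu>l \<mu>h n = (if n \<le> T then \<mu>l else \<mu>h)"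

text \<open>
  The continuous-time Markov chain is built from its jump chain and holding times. In state
  \<open>Some (i, k)\<close> the total jump rate is \<open>lam * p k + \<mu> k\<close>. The next jump is the arrival of a
  joining customer with probability \<open>lam * p k / (lam * p k + \<mu> k)\<close>, decided by a uniform
  variate \<open>u\<close>, and a service completion otherwise. The holding time is a unit exponential
  variate \<open>e\<close> divided by the total jump rate.
\<close>

fun jump_step ::
  "real \<Rightarrow> (nat \<Rightarrow> real) \<Rightarrow> (nat \<Rightarrow> real) \<Rightarrow> real \<Rightarrow> tagged_state \<Rightarrow> tagged_state" where
  "jump_step lam \<mu> p u None = None"
| "jump_step lam \<mu> p u (Some (i, k)) =
     (if u < lam * p k / (lam * p k + \<mu> k) then Some (i, k + 1)
      else if i \<ge> 1 then Some (i - 1, k - 1) else None)"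

fun holding_time ::
  "real \<Rightarrow> (nat \<Rightarrow> real) \<Rightarrow> (nat \<Rightarrow> real) \<Rightarrow> real \<Rightarrow> tagged_state \<Rightarrow> real" where
  "holding_time lam \<mu> p e None = 0"
| "holding_time lam \<mu> p e (Some (i, k)) = e / (lam * p k + \<mu> k)"

primrec jump_chain ::
  "real \<Rightarrow> (nat \<Rightarrow> real) \<Rightarrow> (nat \<Rightarrow> real) \<Rightarrow> tagged_state \<Rightarrow> (nat \<Rightarrow> real \<times> real) \<Rightarrow> nat
    \<Rightarrow> tagged_state" where
  "jump_chain lam \<mu> p s \<omega> 0 = s"
| "jump_chain lam \<mu> p s \<omega> (Suc j) = jump_step lam \<mu> p (fst (\<omega> j)) (jump_chain lam \<mu> p s \<omega> j)"

definition departure_time ::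
  "real \<Rightarrow> (nat \<Rightarrow> real) \<Rightarrow> (nat \<Rightarrow> real) \<Rightarrow> tagged_state \<Rightarrow> (nat \<Rightarrow> real \<times> real) \<Rightarrow> ennreal" where
  "departure_time lam \<mu> p s \<omega> =
     (\<Sum>j. ennreal (holding_time lam \<mu> p (snd (\<omega> j)) (jump_chain lam \<mu> p s \<omega> j)))"

definition variates :: "(nat \<Rightarrow> real \<times> real) measure" where
  "variates =
     (\<Pi>\<^sub>M j\<in>UNIV. uniform_measure lborel {0..1} \<Otimes>\<^sub>M density lborel (exponential_density 1))"

text \<open>
  The delay function is extended-real valued, so that an infinite expected delay is not
  confused with a finite one.
\<close>

definition delay :: "real \<Rightarrow> (nat \<Rightarrow> real) \<Rightarrow> nat \<Rightarrow> nat \<Rightarrow> (nat \<Rightarrow> real) \<Rightarrow> ereal" where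
  "delay lam \<mu> n m p =
     enn2ereal (\<integral>\<^sup>+\<omega>. departure_time lam \<mu> p (Some (n, m)) \<omega> \<partial>variates)"

definition is_strategy :: "(nat \<Rightarrow> real) \<Rightarrow> bool" where
  "is_strategy p \<longleftrightarrow> (\<forall>n. 0 \<le> p n \<and> p n \<le> 1)"

definition first_balk :: "(nat \<Rightarrow> real) \<Rightarrow> nat" where
  "first_balk p = (LEAST n. p n = 0)"

definition threshold_strategy :: "nat \<Rightarrow> nat \<Rightarrow> real" where
  "threshold_strategy n0 n = (if n < n0 then 1 else 0)"

text \<open>\<open>Rt\<close> is the reward divided by the waiting cost per unit of time.\<close>

definition recurrent_class_equilibrium ::
  "real \<Rightarrow> (nat \<Rightarrow> real) \<Rightarrow> real \<Rightarrow> (nat \<Rightarrow> real) \<Rightarrow> bool" where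
  "recurrent_class_equilibrium lam \<mu> Rt p \<longleftrightarrow>
     is_strategy p \<and> (\<exists>n. p n = 0) \<and>
     (\<forall>n \<le> first_balk p.
        (p n = 0 \<longrightarrow> ereal Rt - delay lam \<mu> n (n + 1) p \<le> 0) \<and>
        (p n = 1 \<longrightarrow> ereal Rt - delay lam \<mu> n (n + 1) p \<ge> 0) \<and>
        (0 < p n \<and> p n < 1 \<longrightarrow> ereal Rt - delay lam \<mu> n (n + 1) p = 0))"

definition threshold_equilibrium ::
  "real \<Rightarrow> nat \<Rightarrow> real \<Rightarrow> real \<Rightarrow> real \<Rightarrow> nat \<Rightarrow> bool" where
  "threshold_equilibrium lam T \<mu>l \<mu>h Rt n0 \<longleftrightarrow>
     recurrent_class_equilibrium lam (threshold_rate T \<mu>l \<mu>h) Rt (threshold_strategy n0)"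

end

theory Submission
  imports Defs
begin

text \<open>
  Conditioning on the first variate gives first-step equations for the expected delay. Under a
  threshold strategy they form a finite recursion: the number of customers in front never grows,
  and the number in the system grows only up to the threshold. For \<open>n\<close> below the threshold \<open>n0\<close>,
  induction along this recursion bounds \<open>W(n)\<close> between \<open>(n + 1) / \<mu>h\<close> and \<open>(n + 1) / \<mu>l\<close>, with equality to
  the latter if \<open>n0 \<le> T\<close>, and shows that \<open>W(n)\<close> is nondecreasing in \<open>n\<close>. Hence only the conditions at
  \<open>n0 - 1\<close> and \<open>n0\<close> matter, and \<open>W(n0)\<close> exceeds \<open>W(n0 - 1)\<close> by one mean service time at level \<open>n0 + 1\<close>.
\<close>

section \<open>The variates behind a single jump\<close>

definition stage_variate :: "(real \<times> real) measure" where
  "stage_variate = uniform_measure lborel {0..1} \<Otimes>\<^sub>M density lborel (exponential_density 1)"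

lemma sets_stage_variate [measurable_cong, simp]:
  "sets stage_variate = sets (borel \<Otimes>\<^sub>M borel)"
  unfolding stage_variate_def by (intro sets_pair_measure_cong) simp_all

lemma variates_eq_PiM: "variates = (\<Pi>\<^sub>M j\<in>UNIV. stage_variate)"
  unfolding variates_def stage_variate_def ..

lemma prob_space_uniform_01: "prob_space (uniform_measure lborel {0..1::real})"
  by (rule prob_space_uniform_measure) simp_all

lemma prob_space_stage_variate: "prob_space stage_variate"
proof -
  interpret U: prob_space "uniform_measure lborel {0..1::real}"
    by (rule prob_space_uniform_01)
  interpret E: prob_space "density lborel (exponential_density 1)"
    by (rule prob_space_exponential_density) simp
  interpret pair_prob_space "uniform_measure lborel {0..1::real}" "density lborel (exponential_density 1)" ..
  show ?thesis
    unfolding stage_variate_def by (rule prob_space_axioms)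
qed

lemma nn_integral_exponential_1:
  "(\<integral>\<^sup>+e. ennreal (e / c) \<partial>density lborel (exponential_density 1)) = ennreal (1 / c)"
  if "c > 0"
proof -
  \<comment> \<open>The density vanishes for negative \<open>e\<close>; with \<open>e\<close>
    written as \<open>e ^ 1\<close>, what remains is a Gamma integral of value 1.\<close>
  have "(\<integral>\<^sup>+e. ennreal (e / c) \<partial>density lborel (exponential_density 1)) =
      (\<integral>\<^sup>+e. ennreal (1 / c) * (ennreal (e ^ 1 * exp (- e)) * indicator {0..} e) \<partial>lborel)"
    using that
    by (subst nn_integral_density)
       (auto intro!: nn_integral_cong
         simp: exponential_density_def indicator_def ennreal_mult[symmetric] field_simps)
  also have "\<dots> = ennreal (1 / c) * (\<integral>\<^sup>+e. ennreal (e ^ 1 * exp (- e)) * indicator {0..} e \<partial>lborel)"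
    by (rule nn_integral_cmult) measurable
  also have "\<dots> = ennreal (1 / c)"
    by (subst nn_intergal_power_times_exp_Ici) simp
  finally show ?thesis .
qed

lemma nn_integral_uniform_01_branch:
  assumes "0 \<le> q" "q \<le> 1"
  shows "(\<integral>\<^sup>+u. (if u < q then x else y) \<partial>uniform_measure lborel {0..1::real}) =
      ennreal q * x + ennreal (1 - q) * y"
proof -
  let ?U = "uniform_measure lborel {0..1::real}"
  have "emeasure ?U {..<q} = ennreal q"
  proof -
    have "{0..1} \<inter> {..<q} = {0..<q}" using assms by auto
    then show ?thesis using assms by (simp add: divide_ennreal_def)
  qed
  moreover have "emeasure ?U {q..} = ennreal (1 - q)"
  proof -
    have "{0..1} \<inter> {q..} = {q..1}" using assms by auto
    then show ?thesis using assms by (simp add: divide_ennreal_def)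
  qed
  moreover have "(\<integral>\<^sup>+u. (if u < q then x else y) \<partial>?U) =
      (\<integral>\<^sup>+u. x * indicator {..<q} u + y * indicator {q..} u \<partial>?U)"
    by (intro nn_integral_cong) (auto simp: indicator_def)
  moreover have "\<dots> = x * emeasure ?U {..<q} + y * emeasure ?U {q..}"
    by (simp add: nn_integral_add nn_integral_cmult)
  ultimately show ?thesis by (simp add: mult.commute)
qed

section \<open>Shift and measurability of the jump chain\<close>

lemma jump_chain_Suc_shift:
  "jump_chain lam \<mu> p s (case_nat x \<omega>) (Suc j) =
    jump_chain lam \<mu> p (jump_step lam \<mu> p (fst x) s) \<omega> j"
  by (induction j) simp_all

text \<open>Pathwise form of conditioning on the first variate: \<open>jump_chain\<close> unfolds at
  the last jump, and the shift turns this into splitting off the first one.\<close>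

lemma departure_time_shift:
  "departure_time lam \<mu> p s (case_nat x \<omega>) =
    ennreal (holding_time lam \<mu> p (snd x) s) +
    departure_time lam \<mu> p (jump_step lam \<mu> p (fst x) s) \<omega>"
proof -
  let ?f = "\<lambda>j. ennreal (holding_time lam \<mu> p (snd (case_nat x \<omega> j)) (jump_chain lam \<mu> p s (case_nat x \<omega>) j))"
  have "suminf ?f = (\<Sum>j. ?f (Suc j)) + ?f 0"
    by (intro sums_unique[symmetric] sums_Suc summable_sums) simp
  then show ?thesis
    unfolding departure_time_def
    by (simp add: jump_chain_Suc_shift add.commute del: jump_chain.simps(2))
qed

lemma measurable_jump_step:
  assumes "f \<in> borel_measurable M"
  shows "(\<lambda>\<omega>. jump_step lam \<mu> p (f \<omega>) s) \<in> measurable M (count_space UNIV)"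
proof (cases s)
  case (Some a)
  then show ?thesis using assms by (cases a) simp
qed simp

lemma measurable_holding_time:
  assumes "f \<in> borel_measurable M"
  shows "(\<lambda>\<omega>. holding_time lam \<mu> p (f \<omega>) s) \<in> borel_measurable M"
proof (cases s)
  case (Some a)
  then show ?thesis using assms by (cases a) simp
qed simp

lemma measurable_component_variates:
  "(\<lambda>\<omega>. \<omega> j) \<in> measurable variates (borel \<Otimes>\<^sub>M borel)"
proof -
  have "(\<lambda>\<omega>. \<omega> j) \<in> measurable variates stage_variate"
    unfolding variates_eq_PiM by (rule measurable_component_singleton) simp
  then show ?thesis by (simp cong: measurable_cong_sets)
qed

lemma measurable_fst_component_variates [measurable]:
  "(\<lambda>\<omega>. fst (\<omega> j)) \<in> borel_measurable variates"
  using measurable_component_variates by (rule measurable_compose) simp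

lemma measurable_snd_component_variates [measurable]:
  "(\<lambda>\<omega>. snd (\<omega> j)) \<in> borel_measurable variates"
  using measurable_component_variates by (rule measurable_compose) simp

text \<open>There are only countably many states, so the preceding state may be held fixed while the
  variate varies.\<close>

lemma measurable_jump_chain:
  "(\<lambda>\<omega>. jump_chain lam \<mu> p s \<omega> j) \<in> measurable variates (count_space UNIV)"
proof (induction j)
  case (Suc j)
  show ?case
    unfolding jump_chain.simps
    by (rule measurable_compose_countable[OF _ Suc])
       (rule measurable_jump_step, measurable)
qed simp

lemma measurable_departure_time [measurable]:
  "departure_time lam \<mu> p s \<in> borel_measurable variates"
proof -
  have "(\<lambda>\<omega>. holding_time lam \<mu> p (snd (\<omega> j)) (jump_chain lam \<mu> p s \<omega> j))
      \<in> borel_measurable variates" for j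
    by (rule measurable_compose_countable[OF _ measurable_jump_chain])
       (rule measurable_holding_time, measurable)
  then show ?thesis
    unfolding departure_time_def[abs_def] by measurable
qed

section \<open>First-step equation for the mean departure time\<close>

definition mean_departure_time ::
  "real \<Rightarrow> (nat \<Rightarrow> real) \<Rightarrow> (nat \<Rightarrow> real) \<Rightarrow> tagged_state \<Rightarrow> ennreal" where
  "mean_departure_time lam \<mu> p s = (\<integral>\<^sup>+\<omega>. departure_time lam \<mu> p s \<omega> \<partial>variates)"

lemma mean_departure_time_None [simp]: "mean_departure_time lam \<mu> p None = 0"
proof -
  have "jump_chain lam \<mu> p None \<omega> j = None" for \<omega> j
    by (induction j) simp_all
  then show ?thesis
    by (simp add: mean_departure_time_def departure_time_def)
qed

text \<open>All integrands are nonnegative, so Tonelli applies and the equation holds in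
  \<open>ennreal\<close> before finiteness is known.\<close>

lemma mean_departure_time_Some:
  assumes rates: "lam \<ge> 0" "p k \<ge> 0" "\<mu> k > 0"
  defines "c \<equiv> lam * p k + \<mu> k"
  shows "mean_departure_time lam \<mu> p (Some (i, k)) =
    ennreal (1 / c) + ennreal (lam * p k / c) * mean_departure_time lam \<mu> p (Some (i, k + 1)) +
    ennreal (\<mu> k / c) * mean_departure_time lam \<mu> p (if i \<ge> 1 then Some (i - 1, k - 1) else None)"
proof -
  let ?D = "departure_time lam \<mu> p" and ?m = "mean_departure_time lam \<mu> p"
  let ?U = "uniform_measure lborel {0..1::real}" and ?E = "density lborel (exponential_density 1)"
  let ?s = "Some (i, k)" and ?next = "\<lambda>u. jump_step lam \<mu> p u (Some (i, k))"
  have c: "c > 0" using rates by (simp add: c_def add_nonneg_pos)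
  define q where "q = lam * p k / c"
  have q: "0 \<le> q" "q \<le> 1" "1 - q = \<mu> k / c"
    using rates c by (auto simp: q_def c_def field_simps)
  interpret U: prob_space ?U by (rule prob_space_uniform_01)
  interpret E: prob_space ?E by (rule prob_space_exponential_density) simp
  interpret UE: pair_prob_space ?U ?E ..
  interpret S: sequence_space stage_variate
    by (intro sequence_space.intro product_prob_space.intro product_prob_space_axioms.intro
          product_sigma_finite.intro prob_space_stage_variate
          prob_space_imp_sigma_finite)
  interpret V: prob_space variates
    unfolding variates_eq_PiM by (rule S.prob_space_axioms)
  have shift: "(\<lambda>(x, \<omega>). case_nat x \<omega>) \<in> measurable (stage_variate \<Otimes>\<^sub>M variates) variates"
    unfolding variates_eq_PiM by measurable
  have hold [measurable]: "(\<lambda>x. holding_time lam \<mu> p (snd x) ?s) \<in> borel_measurable stage_variate"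
    by (rule measurable_holding_time) measurable
  have nxt: "(\<lambda>x. ?next (fst x)) \<in> measurable stage_variate (count_space UNIV)"
    by (rule measurable_jump_step) measurable
  have mnxt: "(\<lambda>x. ?m (?next (fst x))) \<in> borel_measurable stage_variate"
    using nxt by (rule measurable_compose) simp
  \<comment> \<open>The stages are independent and identically distributed, so prepending an
    independent stage preserves the law of the sequence.\<close>
  have "?m ?s = (\<integral>\<^sup>+\<omega>. ?D ?s \<omega> \<partial>distr (stage_variate \<Otimes>\<^sub>M variates) variates (\<lambda>(x, \<omega>). case_nat x \<omega>))"
    using S.PiM_iter by (simp add: mean_departure_time_def variates_eq_PiM)
  also have "\<dots> = (\<integral>\<^sup>+y. ?D ?s (case y of (x, \<omega>) \<Rightarrow> case_nat x \<omega>) \<partial>(stage_variate \<Otimes>\<^sub>M variates))"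
    by (rule nn_integral_distr[OF shift]) simp
  also have "\<dots> = (\<integral>\<^sup>+x. \<integral>\<^sup>+\<omega>. ?D ?s (case_nat x \<omega>) \<partial>variates \<partial>stage_variate)"
    by (subst V.nn_integral_fst[symmetric]) (use shift in \<open>auto intro: measurable_compose\<close>)
  also have "\<dots> = (\<integral>\<^sup>+x. ennreal (holding_time lam \<mu> p (snd x) ?s) + ?m (?next (fst x)) \<partial>stage_variate)"
    by (simp only: departure_time_shift, subst nn_integral_add)
       (simp_all add: mean_departure_time_def V.emeasure_space_1)
  also have "\<dots> = (\<integral>\<^sup>+x. ennreal (holding_time lam \<mu> p (snd x) ?s) \<partial>stage_variate) +
      (\<integral>\<^sup>+x. ?m (?next (fst x)) \<partial>stage_variate)"
    using mnxt by (intro nn_integral_add) simp_all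
  also have "(\<integral>\<^sup>+x. ennreal (holding_time lam \<mu> p (snd x) ?s) \<partial>stage_variate) =
      (\<integral>\<^sup>+u. \<integral>\<^sup>+e. ennreal (e / c) \<partial>?E \<partial>?U)"
    unfolding stage_variate_def
    by (subst E.nn_integral_fst[symmetric]) (simp_all add: c_def)
  also have "\<dots> = ennreal (1 / c)"
    using c by (simp add: nn_integral_exponential_1 U.emeasure_space_1)
  also have "(\<integral>\<^sup>+x. ?m (?next (fst x)) \<partial>stage_variate) =
      (\<integral>\<^sup>+u. \<integral>\<^sup>+e. ?m (?next u) \<partial>?E \<partial>?U)"
    using mnxt unfolding stage_variate_def
    by (subst E.nn_integral_fst[symmetric]) simp_all
  \<comment> \<open>The next state depends on the uniform variate only; the exponential one
    integrates out with mass 1.\<close>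
  also have "\<dots> = (\<integral>\<^sup>+u. (if u < q then ?m (Some (i, k + 1)) else
      ?m (if i \<ge> 1 then Some (i - 1, k - 1) else None)) \<partial>?U)"
    using E.emeasure_space_1 by (intro nn_integral_cong) (simp add: q_def c_def)
  also have "\<dots> = ennreal q * ?m (Some (i, k + 1)) +
      ennreal (\<mu> k / c) * ?m (if i \<ge> 1 then Some (i - 1, k - 1) else None)"
    using nn_integral_uniform_01_branch[OF q(1,2)] q(3) by simp
  finally show ?thesis by (simp add: q_def add.assoc)
qed

text \<open>Indexing by the number \<open>j\<close> of services still needed, with \<open>j = 0\<close> for a departed customer,
  makes the first-step equation uniform.\<close>

definition tagged :: "nat \<Rightarrow> nat \<Rightarrow> tagged_state" where
  "tagged j k = (case j of 0 \<Rightarrow> None | Suc i \<Rightarrow> Some (i, k))"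

section \<open>Real-valued sojourn times under a threshold strategy\<close>

locale threshold_queue =
  fixes lam :: real and \<mu> :: "nat \<Rightarrow> real" and N :: nat
  assumes lam_pos: "lam > 0" and rate_pos: "\<mu> k > 0"
begin

abbreviation arrival_rate :: "nat \<Rightarrow> real" where
  "arrival_rate k \<equiv> lam * threshold_strategy N k"

abbreviation mean_time :: "nat \<Rightarrow> nat \<Rightarrow> ennreal" where
  "mean_time j k \<equiv> mean_departure_time lam \<mu> (threshold_strategy N) (tagged j k)"

text \<open>\<open>enn2real\<close> sends infinity to 0; \<open>mean_time_finite\<close> ensures
  that no information is lost.\<close>

definition sojourn :: "nat \<Rightarrow> nat \<Rightarrow> real" where
  "sojourn j k = enn2real (mean_time j k)"

lemma arrival_rate_nonneg: "arrival_rate k \<ge> 0"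
  using lam_pos by (simp add: threshold_strategy_def)

lemma arrival_rate_zero: "N \<le> k \<Longrightarrow> arrival_rate k = 0"
  by (simp add: threshold_strategy_def)

lemma total_rate_pos: "arrival_rate k + \<mu> k > 0"
  using arrival_rate_nonneg rate_pos by (rule add_nonneg_pos)

lemma mean_time_Suc:
  "mean_time (Suc j) k =
    ennreal (1 / (arrival_rate k + \<mu> k)) +
    ennreal (arrival_rate k / (arrival_rate k + \<mu> k)) * mean_time (Suc j) (Suc k) +
    ennreal (\<mu> k / (arrival_rate k + \<mu> k)) * mean_time j (k - 1)"
proof -
  have "(if j \<ge> 1 then Some (j - 1, k - 1) else None) = tagged j (k - 1)"
    by (cases j) (simp_all add: tagged_def)
  moreover have "threshold_strategy N k \<ge> 0"
    by (simp add: threshold_strategy_def)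
  ultimately show ?thesis
    using mean_departure_time_Some[of lam "threshold_strategy N" k \<mu> j] lam_pos rate_pos
    by (simp add: tagged_def)
qed

text \<open>Arrivals stop at level \<open>N\<close>, so the first-step equations form a well-founded recursion.\<close>

lemma first_step_induct [case_names departed step]:
  assumes departed: "\<And>k. P 0 k"
    and step: "\<And>j k. (\<And>l. P j l) \<Longrightarrow> (k < N \<Longrightarrow> P (Suc j) (Suc k)) \<Longrightarrow> P (Suc j) k"
  shows "P j k"
proof (induction j arbitrary: k)
  case (Suc j)
  show ?case
  \<comment> \<open>Below \<open>N\<close> each arrival decreases \<open>N - k\<close>; from
    \<open>N\<close> on the truncated difference is 0 and the premise about \<open>Suc k\<close> is
    void.\<close>
  proof (induction "N - k" arbitrary: k rule: less_induct)
    case less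
    show ?case by (rule step) (auto intro: Suc less)
  qed
qed (rule departed)

text \<open>From level \<open>N\<close> on the upward term has coefficient 0, and 0 times infinity
  is 0 in \<open>ennreal\<close>, so finiteness one level up is needed only where the induction
  supplies it.\<close>

lemma mean_time_finite: "mean_time j k < \<infinity>"
proof (induction j k rule: first_step_induct)
  case (departed k)
  show ?case by (simp add: tagged_def)
next
  case (step j k)
  then show ?case
    by (subst mean_time_Suc, cases "k < N")
       (auto simp: ennreal_mult_less_top arrival_rate_zero)
qed

lemma ennreal_sojourn: "ennreal (sojourn j k) = mean_time j k"
  using mean_time_finite[of j k] by (simp add: sojourn_def)

lemma sojourn_0: "sojourn 0 k = 0"
  by (simp add: sojourn_def tagged_def)

lemma sojourn_nonneg: "sojourn j k \<ge> 0"
  by (simp add: sojourn_def)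

text \<open>Clearing the denominator leaves a linear equation with nonnegative coefficients, ready
  for comparison with sub- and supersolutions.\<close>

lemma sojourn_Suc:
  "(arrival_rate k + \<mu> k) * sojourn (Suc j) k =
    1 + arrival_rate k * sojourn (Suc j) (Suc k) + \<mu> k * sojourn j (k - 1)"
proof -
  let ?a = "arrival_rate k" and ?c = "arrival_rate k + \<mu> k"
  have nonneg: "?a \<ge> 0" "\<mu> k \<ge> 0" "?c > 0"
    using arrival_rate_nonneg rate_pos[of k] total_rate_pos by auto
  have cancel: "c * (1 / c + a / c * x + m / c * y) = 1 + a * x + m * y" if "c > 0"
    for a c m x y :: real
    using that by (simp add: distrib_left)
  have "ennreal (sojourn (Suc j) k) =
      ennreal (1 / ?c + ?a / ?c * sojourn (Suc j) (Suc k) + \<mu> k / ?c * sojourn j (k - 1))"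
    using nonneg sojourn_nonneg mean_time_Suc[of j k]
    by (simp add: ennreal_sojourn[symmetric] ennreal_plus ennreal_mult
          del: times_divide_eq_left times_divide_eq_right)
  then have "sojourn (Suc j) k =
      1 / ?c + ?a / ?c * sojourn (Suc j) (Suc k) + \<mu> k / ?c * sojourn j (k - 1)"
    using nonneg sojourn_nonneg by (subst (asm) ennreal_inj) auto
  then have "?c * sojourn (Suc j) k =
      ?c * (1 / ?c + ?a / ?c * sojourn (Suc j) (Suc k) + \<mu> k / ?c * sojourn j (k - 1))"
    by (rule arg_cong)
  then show ?thesis unfolding cancel[OF nonneg(3)] .
qed

lemma sojourn_Suc_blocked:
  assumes "N \<le> k"
  shows "sojourn (Suc j) k = 1 / \<mu> k + sojourn j (k - 1)"
  using sojourn_Suc[of k j] rate_pos[of k] by (simp add: arrival_rate_zero[OF assms] field_simps)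

lemma delay_eq_sojourn:
  "delay lam \<mu> i k (threshold_strategy N) = ereal (sojourn (Suc i) k)"
proof -
  have "(\<integral>\<^sup>+\<omega>. departure_time lam \<mu> (threshold_strategy N) (Some (i, k)) \<omega> \<partial>variates) =
      ennreal (sojourn (Suc i) k)"
    by (simp add: ennreal_sojourn mean_departure_time_def tagged_def)
  then show ?thesis
    by (simp add: delay_def enn2ereal_ennreal sojourn_nonneg)
qed

section \<open>Bounds and monotonicity of the sojourn times\<close>

lemma sojourn_ge:
  assumes "\<And>k. k \<le> N \<Longrightarrow> \<mu> k \<le> M" and "k \<le> N"
  shows "real j / M \<le> sojourn j k"
  using assms(2)
proof (induction j k rule: first_step_induct)
  case (departed k)
  then show ?case by (simp add: sojourn_0)
next
  case (step j k)
  let ?a = "arrival_rate k" and ?m = "\<mu> k"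
  have m: "0 < ?m" "?m \<le> M" using rate_pos assms(1) step by auto
  have up: "?a * (real (Suc j) / M) \<le> ?a * sojourn (Suc j) (Suc k)"
  proof (cases "k < N")
    case True
    then show ?thesis using step.IH(2) arrival_rate_nonneg by (intro mult_left_mono) auto
  qed (simp add: arrival_rate_zero)
  have down: "?m * (real j / M) \<le> ?m * sojourn j (k - 1)"
    using step m by (intro mult_left_mono) auto
  \<comment> \<open>The function \<open>j / M\<close> solves the first-step equation with
    \<open>?m / M\<close> in place of the constant 1. Since \<open>?m / M\<close> is at most 1, it
    is a subsolution.\<close>
  have "(?a + ?m) * (real (Suc j) / M) = ?m / M + ?a * (real (Suc j) / M) + ?m * (real j / M)"
    by (simp add: add_divide_distrib distrib_left distrib_right)
  moreover have "?m / M \<le> 1" using m by simp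
  ultimately have "(?a + ?m) * (real (Suc j) / M) \<le> (?a + ?m) * sojourn (Suc j) k"
    using up down sojourn_Suc[of k j] by linarith
  then show ?case using total_rate_pos by (rule mult_left_le_imp_le)
qed

text \<open>Mirror image of \<open>sojourn_ge\<close>: now \<open>?m / M\<close> is at least 1, so
  \<open>j / M\<close> is a supersolution.\<close>

lemma sojourn_le:
  assumes "\<And>k. k \<le> N \<Longrightarrow> M \<le> \<mu> k" and "0 < M" and "k \<le> N"
  shows "sojourn j k \<le> real j / M"
  using assms(3)
proof (induction j k rule: first_step_induct)
  case (departed k)
  then show ?case by (simp add: sojourn_0)
next
  case (step j k)
  let ?a = "arrival_rate k" and ?m = "\<mu> k"
  have m: "0 < ?m" "M \<le> ?m" using rate_pos assms(1) step by auto
  have up: "?a * sojourn (Suc j) (Suc k) \<le> ?a * (real (Suc j) / M)"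
  proof (cases "k < N")
    case True
    then show ?thesis using step.IH(2) arrival_rate_nonneg by (intro mult_left_mono) auto
  qed (simp add: arrival_rate_zero)
  have down: "?m * sojourn j (k - 1) \<le> ?m * (real j / M)"
    using step m by (intro mult_left_mono) auto
  have "(?a + ?m) * (real (Suc j) / M) = ?m / M + ?a * (real (Suc j) / M) + ?m * (real j / M)"
    by (simp add: add_divide_distrib distrib_left distrib_right)
  moreover have "1 \<le> ?m / M" using m assms(2) by simp
  ultimately have "(?a + ?m) * sojourn (Suc j) k \<le> (?a + ?m) * (real (Suc j) / M)"
    using up down sojourn_Suc[of k j] by linarith
  then show ?case using total_rate_pos by (rule mult_left_le_imp_le)
qed

text \<open>Algebraic form of a coupling: a second tagged customer with one more customer in front and in
  total sees a system that is never less crowded, and an extra service only resets her to the state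
  of the first one.\<close>

lemma sojourn_diagonal_mono:
  assumes "mono \<mu>" and "j \<le> k"
  shows "sojourn j k \<le> sojourn (Suc j) (Suc k)"
  using assms(2)
proof (induction j k rule: first_step_induct)
  case (departed k)
  then show ?case by (simp add: sojourn_0 sojourn_nonneg)
next
  case (step j k)
  let ?x = "sojourn (Suc j) k" and ?y = "sojourn (Suc (Suc j)) (Suc k)"
  show ?case
  proof (cases "Suc k < N")
    \<comment> \<open>Arrivals are blocked at level \<open>Suc k\<close>, so one service leads
      exactly to the state of \<open>?x\<close>.\<close>
    case False
    then show ?thesis
      using rate_pos[of "Suc k"] by (simp add: sojourn_Suc_blocked)
  next
    case True
    \<comment> \<open>Here \<open>Suc j \<le> k\<close> gives \<open>k > 0\<close>, so the diagonal
      step from level \<open>k - 1\<close> ends at level \<open>k\<close>.\<close>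
    have "sojourn j (k - 1) \<le> ?x"
      using step.IH(1)[of "k - 1"] step.prems by simp
    then have down: "\<mu> k * sojourn j (k - 1) \<le> \<mu> k * ?x"
      using rate_pos[of k] by simp
    have up: "lam * sojourn (Suc j) (Suc k) \<le> lam * sojourn (Suc (Suc j)) (Suc (Suc k))"
      using step True lam_pos by simp
    have x: "(lam + \<mu> k) * ?x = 1 + lam * sojourn (Suc j) (Suc k) + \<mu> k * sojourn j (k - 1)"
      using sojourn_Suc[of k j] True by (simp add: threshold_strategy_def)
    have y: "(lam + \<mu> (Suc k)) * ?y = 1 + lam * sojourn (Suc (Suc j)) (Suc (Suc k)) + \<mu> (Suc k) * ?x"
      using sojourn_Suc[of "Suc k" "Suc j"] True by (simp add: threshold_strategy_def)
    \<comment> \<open>By \<open>x\<close> and \<open>y\<close>, the right side minus the left side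
      is the sum of the gaps in \<open>up\<close> and \<open>down\<close>.\<close>
    have "(lam + \<mu> (Suc k)) * ?x \<le> (lam + \<mu> (Suc k)) * ?y"
      using x y up down by (simp add: distrib_right)
    moreover have "lam + \<mu> (Suc k) > 0"
      using lam_pos rate_pos[of "Suc k"] by simp
    ultimately show ?thesis by simp
  qed
qed

section \<open>Equilibrium condition for a threshold strategy\<close>

lemma first_balk_threshold: "first_balk (threshold_strategy N) = N"
  unfolding first_balk_def threshold_strategy_def by (rule Least_equality) (auto split: if_splits)

text \<open>\<open>sojourn N N\<close> is W(N - 1) if \<open>N > 0\<close> and 0 if
  \<open>N = 0\<close>, so the same two inequalities also cover the strategy that always
  balks.\<close>

lemma equilibrium_iff:
  assumes "mono \<mu>" and "Rt \<ge> 0"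
  shows "recurrent_class_equilibrium lam \<mu> Rt (threshold_strategy N) \<longleftrightarrow>
    sojourn N N \<le> Rt \<and> Rt \<le> 1 / \<mu> (Suc N) + sojourn N N"
proof -
  have "(\<forall>n<N. sojourn (Suc n) (Suc n) \<le> Rt) \<longleftrightarrow> sojourn N N \<le> Rt"
  proof
    assume "\<forall>n<N. sojourn (Suc n) (Suc n) \<le> Rt"
    \<comment> \<open>For \<open>N = 0\<close> the premise is empty and the claim is
      \<open>0 \<le> Rt\<close>.\<close>
    then show "sojourn N N \<le> Rt"
      using assms(2) sojourn_0[of N] by (cases N) auto
  next
    assume le: "sojourn N N \<le> Rt"
    have "sojourn m m \<le> sojourn n n" if "m \<le> n" for m n
      using sojourn_diagonal_mono[OF assms(1)] by (intro lift_Suc_mono_le[OF _ that]) simp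
    then show "\<forall>n<N. sojourn (Suc n) (Suc n) \<le> Rt"
      using le by (meson Suc_leI order_trans)
  qed
  moreover have "recurrent_class_equilibrium lam \<mu> Rt (threshold_strategy N) \<longleftrightarrow>
      (\<forall>n<N. sojourn (Suc n) (Suc n) \<le> Rt) \<and> Rt \<le> sojourn (Suc N) (Suc N)"
    unfolding recurrent_class_equilibrium_def first_balk_threshold delay_eq_sojourn
    by (auto simp: is_strategy_def threshold_strategy_def le_less all_conj_distrib)
  ultimately show ?thesis
    by (simp add: sojourn_Suc_blocked)
qed

end

section \<open>Equilibrium thresholds in the two ranges\<close>

theorem theorem3:
  fixes lam \<mu>l \<mu>h R C Rt :: real and T :: nat
  assumes "lam > 0" and "T > 0" and "0 < \<mu>l" and "\<mu>l < \<mu>h"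
    and "R \<ge> 0" and "C > 0" and "Rt = R / C"
  shows
    "card {n \<in> {0..T}. threshold_equilibrium lam T \<mu>l \<mu>h Rt n} \<le> 2
     \<and> (Rt * \<mu>l \<le> real T \<and> Rt * \<mu>l \<in> \<int> \<longrightarrow>
         (\<exists>n2 \<in> {0..T}. real n2 = Rt * \<mu>l \<and> threshold_equilibrium lam T \<mu>l \<mu>h Rt n2 \<and>
           (R > 0 \<longrightarrow>
             (\<exists>n1 \<in> {0..T}. n1 \<noteq> n2 \<and> real n1 = Rt * \<mu>l - 1 \<and>
                threshold_equilibrium lam T \<mu>l \<mu>h Rt n1))))
     \<and> (Rt * \<mu>l < real T \<and> Rt * \<mu>l \<notin> \<int> \<longrightarrow>
         {n \<in> {0..T}. threshold_equilibrium lam T \<mu>l \<mu>h Rt n} = {nat \<lfloor>Rt * \<mu>l\<rfloor>})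
     \<and> (real T < Rt * \<mu>l \<and> Rt * \<mu>l \<le> real T + \<mu>l / \<mu>h \<longrightarrow>
         int T = \<lfloor>Rt * \<mu>l\<rfloor> \<and>
         {n \<in> {0..T}. threshold_equilibrium lam T \<mu>l \<mu>h Rt n} = {T})
     \<and> (Rt * \<mu>l > real T + \<mu>l / \<mu>h \<longrightarrow>
         \<not> (\<exists>n \<in> {0..T}. threshold_equilibrium lam T \<mu>l \<mu>h Rt n))
     \<and> (\<forall>n \<ge> T + 1. threshold_equilibrium lam T \<mu>l \<mu>h Rt n \<longleftrightarrow>
         max ((Rt - 1 / \<mu>h) * \<mu>l) (real (T + 1)) \<le> real n \<and>
         real n \<le> max (Rt * \<mu>h) (real (T + 1)) \<and>
         ereal (Rt - 1 / \<mu>h)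
           \<le> delay lam (threshold_rate T \<mu>l \<mu>h) (n - 1) n (threshold_strategy n) \<and>
         delay lam (threshold_rate T \<mu>l \<mu>h) (n - 1) n (threshold_strategy n) \<le> ereal Rt)"
proof -
  let ?\<mu> = "threshold_rate T \<mu>l \<mu>h" and ?eq = "threshold_equilibrium lam T \<mu>l \<mu>h Rt"
  \<comment> \<open>\<open>r\<close> is the reward measured in slow mean service times.\<close>
  define r where "r = Rt * \<mu>l"
  have Rt: "Rt \<ge> 0" using assms by simp
  have r: "r \<ge> 0" using Rt assms by (simp add: r_def)
  have Rt_r: "Rt = r / \<mu>l" using assms by (simp add: r_def)
  have ratio: "0 < \<mu>l / \<mu>h" "\<mu>l / \<mu>h < 1" using assms by auto
  have mono: "mono ?\<mu>" using assms by (auto simp: mono_def threshold_rate_def)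
  have queue: "threshold_queue lam ?\<mu>"
    using assms by unfold_locales (auto simp: threshold_rate_def)
  let ?v = "\<lambda>n. threshold_queue.sojourn lam ?\<mu> n n n"
  have eq_iff: "?eq n \<longleftrightarrow> ?v n \<le> Rt \<and> Rt \<le> 1 / ?\<mu> (Suc n) + ?v n" for n
    unfolding threshold_equilibrium_def
    using threshold_queue.equilibrium_iff[OF queue mono Rt] .
  \<comment> \<open>All levels up to \<open>n\<close> are slow, so the lower and upper bounds, both
    with \<open>M = \<mu>l\<close>, coincide.\<close>
  have low: "?v n = real n / \<mu>l" if "n \<le> T" for n
    using that assms(3)
    by (intro antisym threshold_queue.sojourn_ge[OF queue] threshold_queue.sojourn_le[OF queue])
       (auto simp: threshold_rate_def)
  have slow: "?eq n \<longleftrightarrow> real n \<le> r \<and> r \<le> real n + 1" if "n < T" for n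
    using that assms(3) unfolding eq_iff low[OF less_imp_le[OF that]] unfolding Rt_r
    by (simp add: threshold_rate_def field_simps)
  \<comment> \<open>A customer who joins at \<open>T\<close> raises the level to
    \<open>T + 1\<close>, where service is fast; hence the upper end is
    \<open>T + \<mu>l / \<mu>h\<close> instead of \<open>T + 1\<close>.\<close>
  have at_T: "?eq T \<longleftrightarrow> real T \<le> r \<and> r \<le> real T + \<mu>l / \<mu>h"
    using assms(3,4) unfolding eq_iff low[OF order_refl] unfolding Rt_r
    by (simp add: threshold_rate_def field_simps)
  let ?E = "{n \<in> {0..T}. ?eq n}"
  have E_bounds: "real n \<le> r \<and> r \<le> real n + 1" if "n \<in> ?E" for n
    using that slow[of n] at_T ratio by (cases "n = T") auto
  \<comment> \<open>An integer between \<open>r - 1\<close> and \<open>r\<close> is the floor of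
    \<open>r\<close> or, when \<open>r\<close> is an integer, possibly one less. Truncated
    subtraction merges the two values when the floor is 0.\<close>
  have "?E \<subseteq> {nat \<lfloor>r\<rfloor> - 1, nat \<lfloor>r\<rfloor>}"
  proof
    fix n assume "n \<in> ?E"
    with E_bounds[of n] show "n \<in> {nat \<lfloor>r\<rfloor> - 1, nat \<lfloor>r\<rfloor>}" by auto linarith+
  qed
  then have "card ?E \<le> card {nat \<lfloor>r\<rfloor> - 1, nat \<lfloor>r\<rfloor>}" by (intro card_mono) auto
  also have "\<dots> \<le> 2" by (simp add: card_insert_if)
  finally have at_most_2: "card ?E \<le> 2" .

  have integer: "\<exists>n2 \<in> {0..T}. real n2 = r \<and> ?eq n2 \<and>
      (R > 0 \<longrightarrow> (\<exists>n1 \<in> {0..T}. n1 \<noteq> n2 \<and> real n1 = r - 1 \<and> ?eq n1))"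
    if le: "r \<le> real T" and int: "r \<in> \<int>"
  proof -
    obtain n where n: "r = real n"
      using int r by (metis Ints_cases nonneg_int_cases of_int_0_le_iff of_int_of_nat_eq)
    have "?eq n"
      using le slow[of n] at_T ratio n by (cases "n = T") auto
    moreover have "\<exists>n1 \<in> {0..T}. n1 \<noteq> n \<and> real n1 = r - 1 \<and> ?eq n1" if "R > 0"
    proof (cases n)
      \<comment> \<open>\<open>n = 0\<close> would mean \<open>r = 0\<close> and hence
        \<open>R = 0\<close>.\<close>
      case 0
      then show ?thesis using n that assms by (simp add: r_def)
    next
      case (Suc m)
      \<comment> \<open>Here \<open>m < T\<close> even if \<open>n = T\<close>, and
        \<open>r = m + 1\<close> is the upper end of the interval in \<open>slow\<close>.\<close>
      then show ?thesis using n le slow[of m] by (intro bexI[of _ m]) auto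
    qed
    ultimately show ?thesis using n le by (intro bexI[of _ n]) auto
  qed

  have noninteger: "?E = {nat \<lfloor>r\<rfloor>}" if "r < real T" "r \<notin> \<int>"
  proof -
    have "nat \<lfloor>r\<rfloor> < T" using that r by linarith
    then have "nat \<lfloor>r\<rfloor> \<in> ?E" using slow[of "nat \<lfloor>r\<rfloor>"] r by auto
    moreover have "n = nat \<lfloor>r\<rfloor>" if "n \<in> ?E" for n
    proof -
      \<comment> \<open>This makes the upper bound on \<open>r\<close> strict, which identifies
        \<open>n\<close> as the floor.\<close>
      have "r \<noteq> real n + 1"
        using \<open>r \<notin> \<int>\<close> by (metis Ints_1 Ints_add Ints_of_nat)
      with E_bounds[OF that] show ?thesis by linarith
    qed
    ultimately show ?thesis by blast
  qed

  have boundary: "int T = \<lfloor>r\<rfloor> \<and> ?E = {T}" if "real T < r" "r \<le> real T + \<mu>l / \<mu>h"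
  proof
    show "int T = \<lfloor>r\<rfloor>" using that ratio by linarith
    show "?E = {T}"
    proof (intro set_eqI iffI)
      fix n assume n: "n \<in> ?E"
      with E_bounds[OF n] that show "n \<in> {T}" by simp
    qed (use that at_T in auto)
  qed

  have none: "\<not> (\<exists>n \<in> {0..T}. ?eq n)" if "r > real T + \<mu>l / \<mu>h"
  proof
    assume "\<exists>n \<in> {0..T}. ?eq n"
    then obtain n where "n \<in> ?E" by auto
    \<comment> \<open>\<open>r > T\<close> and \<open>r \<le> n + 1\<close> leave only
      \<open>n = T\<close>, which \<open>at_T\<close> excludes.\<close>
    with E_bounds[of n] that ratio have "n = T" by auto
    with \<open>n \<in> ?E\<close> at_T that show False by simp
  qed

  have high: "?eq n \<longleftrightarrow>
      max ((Rt - 1 / \<mu>h) * \<mu>l) (real (T + 1)) \<le> real n \<and>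
      real n \<le> max (Rt * \<mu>h) (real (T + 1)) \<and>
      ereal (Rt - 1 / \<mu>h) \<le> delay lam ?\<mu> (n - 1) n (threshold_strategy n) \<and>
      delay lam ?\<mu> (n - 1) n (threshold_strategy n) \<le> ereal Rt"
    if "n \<ge> T + 1" for n
  proof -
    have delay: "delay lam ?\<mu> (n - 1) n (threshold_strategy n) = ereal (?v n)"
      using threshold_queue.delay_eq_sojourn[OF queue, of "n - 1" n n] that by simp
    have "?v n \<ge> real n / \<mu>h"
      using assms by (intro threshold_queue.sojourn_ge[OF queue]) (auto simp: threshold_rate_def)
    then have ge: "real n \<le> ?v n * \<mu>h"
      using assms by (simp add: pos_divide_le_eq)
    have "?v n \<le> real n / \<mu>l"
      using assms by (intro threshold_queue.sojourn_le[OF queue]) (auto simp: threshold_rate_def)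
    then have le: "?v n * \<mu>l \<le> real n"
      using assms by (simp add: pos_le_divide_eq)
    \<comment> \<open>Level \<open>n + 1\<close> lies above \<open>T\<close>, so the extra service
      takes mean time \<open>1 / \<mu>h\<close>.\<close>
    have "?eq n \<longleftrightarrow> ?v n \<le> Rt \<and> Rt - 1 / \<mu>h \<le> ?v n"
      using that by (auto simp: eq_iff threshold_rate_def)
    \<comment> \<open>The range for \<open>n\<close> is a consequence of the two delay inequalities:
      the crude bounds on \<open>?v n\<close> turn each of them into one end of the range.\<close>
    moreover have "real n \<le> Rt * \<mu>h" if "?v n \<le> Rt"
      using ge mult_right_mono[OF that, of \<mu>h] assms by linarith
    moreover have "(Rt - 1 / \<mu>h) * \<mu>l \<le> real n" if "Rt - 1 / \<mu>h \<le> ?v n"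
      using le mult_right_mono[OF that, of \<mu>l] assms by linarith
    ultimately show ?thesis
      using that unfolding delay by auto
  qed

  show ?thesis
    using at_most_2 integer noninteger boundary none high unfolding r_def by blast
qed

end
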